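(* Let $\mathit{accel}$ be the partial function defined on exactly those pairs $(\langle\chi,\vec a\rangle,\check\phi)$ (a loop and a quantifier-free formula over $\vec x$) for which \[ \check\phi(\vec x)\land\chi(\vec x)\implies\chi(\vec a(\vec x)) \] is valid, by \[ \mathit{accel}(\langle\chi,\vec a\rangle,\check\phi):=\bigl(\vec x'=\vec a^n(\vec x)\land\chi(\vec x)\bigr). \] Then $\mathit{accel}$ is an exact conditional acceleration technique.
   Context: Fix $d\ge 1$, integer variables $\vec x=(x_1,\dots,x_d)$, $\vec x'$, and $n$ ranging over $\mathbb N$; $\vec y=(\vec x,n,\vec x')$. A loop $\langle\chi,\vec a\rangle$ consists of a quantifier-free formula $\chi$ over atoms $p>0$ ($p$ an arithmetic expression over $\vec x$, integer semantics) and a map $\vec a:\mathbb Z^d\to\mathbb Z^d$ given by expressions over $\vec x$; $\vec a^m$ is $m$-fold application. $\vec x\longrightarrow_{\langle\chi,\vec a\rangle}\vec x'$ iff $\chi(\vec x)\land\vec x'=\vec a(\vec x)$, and $\longrightarrow^m$ is its $m$-fold composition. A conditional acceleration technique is a partial function $\mathit{accel}$ from pairs (loop $\langle\chi,\vec a\rangle$, quantifier-free formula $\check\phi$ over $\vec x$) to formulas over $\vec y$. It is sound if for all arguments in its domain, all $\vec x,\vec x'\in\mathbb Z^d$ and all $n>0$, $\vec x\longrightarrow^n_{\langle\check\phi,\vec a\rangle}\vec x'\land\mathit{accel}(\langle\chi,\vec a\rangle,\check\phi)$ implies $\vec x\longrightarrow^n_{\langle\chi,\vec a\rangle}\vec x'$;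 it is exact if it is sound and additionally $\vec x\longrightarrow^n_{\langle\chi\land\check\phi,\vec a\rangle}\vec x'$ implies $\mathit{accel}(\langle\chi,\vec a\rangle,\check\phi)$. Validity means truth for all integer values of the free variables. *)

theory Defs
  imports "HOL-Analysis.Finite_Cartesian_Product"
begin

text \<open>
  Expressions over variables \<open>'v\<close>. Besides integer constants and ring operations, an
  expression may use further operation symbols \<open>'f\<close> (division, exponentiation, ...), whose
  meaning on the integers is given by an arbitrary interpretation \<open>I\<close>.
\<close>

datatype ('f, 'v) expr =
    Var 'v
  | Const int
  | Add "('f, 'v) expr" "('f, 'v) expr"
  | Sub "('f, 'v) expr" "('f, 'v) expr"
  | Mul "('f, 'v) expr" "('f, 'v) expr"
  | Op 'f "('f, 'v) expr list"

type_synonym 'f interp = "'f \<Rightarrow> int list \<Rightarrow> int"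

primrec eval :: "'f interp \<Rightarrow> ('v \<Rightarrow> int) \<Rightarrow> ('f, 'v) expr \<Rightarrow> int" where
  "eval I \<sigma> (Var v) = \<sigma> v"
| "eval I \<sigma> (Const c) = c"
| "eval I \<sigma> (Add p q) = eval I \<sigma> p + eval I \<sigma> q"
| "eval I \<sigma> (Sub p q) = eval I \<sigma> p - eval I \<sigma> q"
| "eval I \<sigma> (Mul p q) = eval I \<sigma> p * eval I \<sigma> q"
| "eval I \<sigma> (Op f ps) = I f (map (eval I \<sigma>) ps)"

datatype 'a form =
    Atom 'a
  | Neg "'a form"
  | Conj "'a form" "'a form"
  | Disj "'a form" "'a form"

primrec sat :: "('a \<Rightarrow> bool) \<Rightarrow> 'a form \<Rightarrow> bool" where
  "sat A (Atom p) \<longleftrightarrow> A p"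
| "sat A (Neg F) \<longleftrightarrow> \<not> sat A F"
| "sat A (Conj F G) \<longleftrightarrow> sat A F \<and> sat A G"
| "sat A (Disj F G) \<longleftrightarrow> sat A F \<or> sat A G"

text \<open>
  The program variables are indexed by the finite type \<open>'d\<close>, so states are vectors in
  \<open>int ^ 'd\<close>. In a formula over the program variables, \<open>Atom p\<close> stands for \<open>p > 0\<close>.
\<close>

type_synonym ('f, 'd) xform = "('f, 'd) expr form"

definition holds :: "'f interp \<Rightarrow> ('f, 'd::finite) xform \<Rightarrow> int ^ 'd \<Rightarrow> bool" where
  "holds I F x \<longleftrightarrow> sat (\<lambda>p. eval I (($) x) p > 0) F"

type_synonym ('f, 'd) update = "('f, 'd) expr ^ 'd"

definition app :: "'f interp \<Rightarrow> ('f, 'd::finite) update \<Rightarrow> int ^ 'd \<Rightarrow> int ^ 'd" where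
  "app I a x = (\<chi> i. eval I (($) x) (a $ i))"

type_synonym ('f, 'd) loop = "('f, 'd) xform \<times> ('f, 'd) update"

definition step :: "'f interp \<Rightarrow> ('f, 'd::finite) loop \<Rightarrow> (int ^ 'd) rel" where
  "step I L = {(x, x'). holds I (fst L) x \<and> x' = app I (snd L) x}"

text \<open>
  Formulas over \<open>(x, n, x')\<close>. As \<open>x' = a\<^sup>n(x)\<close> need not be expressible by atoms \<open>p > 0\<close> alone,
  these formulas have it as an additional kind of atom, \<open>IterEq a\<close>.
\<close>

datatype 'd yvar = Pre 'd | Cnt | Post 'd

primrec yval :: "int ^ 'd \<Rightarrow> nat \<Rightarrow> int ^ 'd \<Rightarrow> 'd::finite yvar \<Rightarrow> int" where
  "yval x n x' (Pre i) = x $ i"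
| "yval x n x' Cnt = int n"
| "yval x n x' (Post i) = x' $ i"

datatype ('f, 'd::finite) yatom =
    Pos "('f, 'd yvar) expr"
  | IterEq "('f, 'd) update"

primrec holds_yatom ::
  "'f interp \<Rightarrow> int ^ 'd \<Rightarrow> nat \<Rightarrow> int ^ 'd \<Rightarrow> ('f, 'd::finite) yatom \<Rightarrow> bool" where
  "holds_yatom I x n x' (Pos p) \<longleftrightarrow> eval I (yval x n x') p > 0"
| "holds_yatom I x n x' (IterEq a) \<longleftrightarrow> x' = (app I a ^^ n) x"

type_synonym ('f, 'd) yform = "('f, 'd) yatom form"

definition holds_y ::
  "'f interp \<Rightarrow> ('f, 'd::finite) yform \<Rightarrow> int ^ 'd \<Rightarrow> nat \<Rightarrow> int ^ 'd \<Rightarrow> bool" where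
  "holds_y I \<psi> x n x' \<longleftrightarrow> sat (holds_yatom I x n x') \<psi>"

definition to_yform :: "('f, 'd::finite) xform \<Rightarrow> ('f, 'd) yform" where
  "to_yform F = map_form (\<lambda>p. Pos (map_expr id Pre p)) F"

type_synonym ('f, 'd) technique =
  "(('f, 'd) loop \<times> ('f, 'd) xform) \<rightharpoonup> ('f, 'd) yform"

definition sound_technique :: "'f interp \<Rightarrow> ('f, 'd::finite) technique \<Rightarrow> bool" where
  "sound_technique I acc \<longleftrightarrow>
    (\<forall>\<phi> a \<phi>\<^sub>c \<psi>. acc ((\<phi>, a), \<phi>\<^sub>c) = Some \<psi> \<longrightarrow>
      (\<forall>x x' n. n > 0 \<longrightarrow>
        (x, x') \<in> step I (\<phi>\<^sub>c, a) ^^ n \<and> holds_y I \<psi> x n x' \<longrightarrow>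
        (x, x') \<in> step I (\<phi>, a) ^^ n))"

definition exact_technique :: "'f interp \<Rightarrow> ('f, 'd::finite) technique \<Rightarrow> bool" where
  "exact_technique I acc \<longleftrightarrow> sound_technique I acc \<and>
    (\<forall>\<phi> a \<phi>\<^sub>c \<psi>. acc ((\<phi>, a), \<phi>\<^sub>c) = Some \<psi> \<longrightarrow>
      (\<forall>x x' n. n > 0 \<longrightarrow>
        (x, x') \<in> step I (Conj \<phi> \<phi>\<^sub>c, a) ^^ n \<longrightarrow>
        holds_y I \<psi> x n x'))"

fun accel :: "'f interp \<Rightarrow> ('f, 'd::finite) technique" where
  "accel I ((\<phi>, a), \<phi>\<^sub>c) =
    (if \<forall>x. holds I \<phi>\<^sub>c x \<and> holds I \<phi> x \<longrightarrow> holds I \<phi> (app I a x)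
     then Some (Conj (Atom (IterEq a)) (to_yform \<phi>))
     else None)"

end

theory Submission imports Defs begin

text \<open>The update is deterministic, so an n-step run is the orbit of x under
  \<open>app I a\<close> with the guard true at the first n points (\<open>step_relpow_iff\<close>).
  The domain condition of \<open>accel\<close> makes \<phi> inductive wherever
  \<open>\<phi>\<^sub>c\<close> holds, so \<phi> at x spreads along an orbit on which
  \<open>\<phi>\<^sub>c\<close> holds (\<open>holds_funpow_app\<close>); this is soundness.
  Conversely, a run with both guards yields the final state and \<phi> at its first point.\<close>

lemma eval_map_expr: "eval I \<sigma> (map_expr id g p) = eval I (\<sigma> \<circ> g) p"
  by (induction p) (simp_all cong: map_cong)

lemma sat_map_form: "sat A (map_form f F) \<longleftrightarrow> sat (A \<circ> f) F"
  by (induction F) simp_all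

lemma holds_y_to_yform: "holds_y I (to_yform F) x n x' \<longleftrightarrow> holds I F x"
proof -
  have "yval x n x' \<circ> Pre = ($) x"
    by (simp add: fun_eq_iff)
  then show ?thesis
    by (simp add: holds_y_def to_yform_def holds_def sat_map_form comp_def eval_map_expr)
qed

lemma step_relpow_iff:
  "(x, x') \<in> step I (F, a) ^^ n \<longleftrightarrow>
    x' = (app I a ^^ n) x \<and> (\<forall>m<n. holds I F ((app I a ^^ m) x))"
proof (induction n arbitrary: x')
  case 0
  then show ?case by auto
next
  case (Suc n)
  then show ?case by (auto simp: step_def relcomp_unfold less_Suc_eq)
qed

text \<open>Induction on m: passing from iterate k to its successor uses \<open>G\<close> at iterate
  k only, so \<open>G\<close> is required strictly before m and not at m itself.\<close>

lemma holds_funpow_app: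
  assumes inv: "\<And>y. holds I G y \<Longrightarrow> holds I F y \<Longrightarrow> holds I F (app I a y)"
    and "holds I F x"
    and "\<And>k. k < m \<Longrightarrow> holds I G ((app I a ^^ k) x)"
  shows "holds I F ((app I a ^^ m) x)"
  using assms(2,3) by (induction m) (simp_all add: inv)

theorem theorem8:
  fixes I :: "'f interp"
  shows "exact_technique I (accel I :: ('f, 'd::finite) technique)"
  unfolding exact_technique_def sound_technique_def
proof (intro conjI allI impI)
  fix \<phi> \<phi>\<^sub>c :: "('f, 'd) xform" and a :: "('f, 'd) update" and \<psi> x x' and n :: nat
  assume acc: "accel I ((\<phi>, a), \<phi>\<^sub>c) = Some \<psi>"
    and *: "(x, x') \<in> step I (\<phi>\<^sub>c, a) ^^ n \<and> holds_y I \<psi> x n x'"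
  from acc have inv: "\<And>y. holds I \<phi>\<^sub>c y \<Longrightarrow> holds I \<phi> y \<Longrightarrow> holds I \<phi> (app I a y)"
    and \<psi>: "\<psi> = Conj (Atom (IterEq a)) (to_yform \<phi>)"
    by (auto split: if_splits)
  from * \<psi> have "holds I \<phi> x"
    by (simp add: holds_y_def holds_y_to_yform[unfolded holds_y_def])
  \<comment> \<open>Both loops share the update, so only the guard has to be transferred: for m < n,
    all iterates before m satisfy \<open>\<phi>\<^sub>c\<close>.\<close>
  with * show "(x, x') \<in> step I (\<phi>, a) ^^ n"
    by (auto simp: step_relpow_iff intro: holds_funpow_app[OF inv])
next
  fix \<phi> \<phi>\<^sub>c :: "('f, 'd) xform" and a :: "('f, 'd) update" and \<psi> x x' and n :: nat
  assume acc: "accel I ((\<phi>, a), \<phi>\<^sub>c) = Some \<psi>" and "n > 0"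
    and *: "(x, x') \<in> step I (Conj \<phi> \<phi>\<^sub>c, a) ^^ n"
  from acc have \<psi>: "\<psi> = Conj (Atom (IterEq a)) (to_yform \<phi>)"
    by (auto split: if_splits)
  \<comment> \<open>Because n > 0, the index m = 0 is in range, which gives \<phi> at x; an empty
    run would say nothing about the guard.\<close>
  from * \<open>n > 0\<close> have "x' = (app I a ^^ n) x" "holds I \<phi> x"
    by (auto simp: step_relpow_iff holds_def)
  then show "holds_y I \<psi> x n x'"
    by (simp add: \<psi> holds_y_def holds_y_to_yform[unfolded holds_y_def])
qed

end
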